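(* Let $q$ be a prime power and let $\mathcal{S}=(s_i)_{i=0}^\infty$ be an ultimately periodic sequence over the finite field $\mathbb{F}_q$ with preperiod $t$, linear complexity $L=L(\mathcal{S})$, and generating function $G(x)=\sum_{i=0}^\infty s_i x^i\neq 0$. Then, for every positive integer $N$, $$E_N(\mathcal{S})\ge \begin{cases} L-t+1 & \text{for } N>(L-t)\,(L-\min\{1,t-1\}),\\ \left\lceil \dfrac{N}{L-\min\{1,t-1\}}\right\rceil & \text{otherwise,}\end{cases}$$ and $$E_N(\mathcal{S})\le L+\max\{-1,-t+1\}.$$
   Context: $\mathbb{F}_q$ is the finite field with $q$ elements. For a sequence $\mathcal{S}=(s_i)_{i=0}^\infty$ over $\mathbb{F}_q$ and a positive integer $N$, the $N$th linear complexity $L_N=L_N(\mathcal{S})$ is the length of a shortest linear recurrence $s_{i+L_N}+\sum_{\ell=0}^{L_N-1}c_\ell s_{i+\ell}=0$, $0\le i\le N-L_N-1$, with coefficients $c_\ell\in\mathbb{F}_q$, which is satisfied by the first $N$ terms of the sequence (with the convention $L_N=0$ if $s_0=\cdots=s_{N-1}=0$, and $L_N=N$ if $s_0=\cdots=s_{N-2}=0\neq s_{N-1}$). The linear complexity is $L(\mathcal{S})=\sup_{N\ge1}L_N(\mathcal{S})$; it is finite if and only if $\mathcal{S}$ is ultimately periodic. An ultimately periodic sequence has preperiod $t\ge 0$ and period $T\ge1$ if $s_{i+t+T}=s_{i+t}$ for all $i\ge 0$; "the preperiod" is the least such $t$ ($t=0$ meaning purely periodic). The generating function of $\mathcal{S}$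 is the formal power series $G(x)=\sum_{i=0}^\infty s_ix^i\in\mathbb{F}_q[[x]]$. The $N$th expansion complexity $E_N(\mathcal{S})$ is defined as follows: $E_N(\mathcal{S})=0$ if $s_0=\cdots=s_{N-1}=0$, and otherwise $E_N(\mathcal{S})$ is the least total degree of a nonzero polynomial $h(x,y)\in\mathbb{F}_q[x,y]$ with $h(x,G(x))\equiv 0 \bmod x^N$.
   Formalization: The lower bound is stated only for N such that s_0,...,s_{N-1} are not all zero; otherwise E_N = 0 by convention while the claimed lower bound is at least 1, e.g. for 0,1,0,1,... with N = 1. *)

theory Defs
  imports
    "HOL-Computational_Algebra.Polynomial_FPS"
    "HOL-Library.Extended_Nat"
begin

definition has_preperiod_period :: "(nat \<Rightarrow> 'a) \<Rightarrow> nat \<Rightarrow> nat \<Rightarrow> bool" where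
  "has_preperiod_period s t T \<longleftrightarrow> T \<ge> 1 \<and> (\<forall>i. s (i + t + T) = s (i + t))"

definition ultimately_periodic :: "(nat \<Rightarrow> 'a) \<Rightarrow> bool" where
  "ultimately_periodic s \<longleftrightarrow> (\<exists>t T. has_preperiod_period s t T)"

definition preperiod :: "(nat \<Rightarrow> 'a) \<Rightarrow> nat" where
  "preperiod s = (LEAST t. \<exists>T. has_preperiod_period s t T)"


definition satisfies_recurrence ::
  "(nat \<Rightarrow> 'a::comm_ring_1) \<Rightarrow> nat \<Rightarrow> nat \<Rightarrow> (nat \<Rightarrow> 'a) \<Rightarrow> bool" where
  "satisfies_recurrence s N L c \<longleftrightarrow>
     (\<forall>i. i + L < N \<longrightarrow> s (i + L) + (\<Sum>l<L. c l * s (i + l)) = 0)"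

text \<open>The two usual conventions (value 0 if the first N terms vanish, value N if the first
  nonzero term is the N-th one) are consequences of this definition; see the two lemmas
  below. The length N recurrence holds vacuously, so the minimum exists.\<close>

definition Nth_linear_complexity :: "(nat \<Rightarrow> 'a::comm_ring_1) \<Rightarrow> nat \<Rightarrow> nat" where
  "Nth_linear_complexity s N = (LEAST L. \<exists>c. satisfies_recurrence s N L c)"

definition linear_complexity :: "(nat \<Rightarrow> 'a::comm_ring_1) \<Rightarrow> enat" where
  "linear_complexity s = (SUP N\<in>{1..}. enat (Nth_linear_complexity s N))"

lemma Nth_linear_complexity_le:
  "satisfies_recurrence s N L c \<Longrightarrow> Nth_linear_complexity s N \<le> L"
  unfolding Nth_linear_complexity_def by (rule Least_le) blast

lemma Nth_linear_complexity_eq_0: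
  assumes "\<And>i. i < N \<Longrightarrow> s i = 0"
  shows "Nth_linear_complexity s N = 0"
  using Nth_linear_complexity_le[of s N 0 "\<lambda>_. 0"] assms
  by (simp add: satisfies_recurrence_def)

lemma Nth_linear_complexity_eq_N:
  assumes "N \<ge> 1" and zero: "\<And>i. i < N - 1 \<Longrightarrow> s i = 0" and nz: "s (N - 1) \<noteq> 0"
  shows "Nth_linear_complexity s N = N"
proof -
  have "N \<le> L" if rec: "satisfies_recurrence s N L c" for L c
  proof (rule ccontr)
    assume "\<not> N \<le> L"
    then have L: "L < N" by simp
    have "s (N - 1 - L + L) + (\<Sum>l<L. c l * s (N - 1 - L + l)) = 0"
      using L by (intro rec[unfolded satisfies_recurrence_def, rule_format]) simp
    moreover have "(\<Sum>l<L. c l * s (N - 1 - L + l)) = 0"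
      proof (rule sum.neutral, rule ballI)
      fix l assume "l \<in> {..<L}"
      then have "s (N - 1 - L + l) = 0" using L by (intro zero) simp
      then show "c l * s (N - 1 - L + l) = 0" by (simp only: mult_zero_right)
    qed
    moreover have "N - 1 - L + L = N - 1" using L by simp
    ultimately show False using nz by (simp only: add_0_right)
  qed
  moreover have "satisfies_recurrence s N N (\<lambda>_. 0)"
    by (simp add: satisfies_recurrence_def)
  ultimately show ?thesis
    unfolding Nth_linear_complexity_def by (intro Least_equality) auto
qed

lemma linear_complexity_finite:
  fixes s :: "nat \<Rightarrow> 'a::comm_ring_1"
  assumes "ultimately_periodic s"
  shows "linear_complexity s \<noteq> \<infinity>"
proof -
  from assms obtain t T where T: "T \<ge> 1" and per: "\<And>i. s (i + t + T) = s (i + t)"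
    unfolding ultimately_periodic_def has_preperiod_period_def by blast
  have "s (i + (t + T)) + (\<Sum>l<t + T. (if l = t then - 1 else 0) * s (i + l)) = 0" for i
  proof -
    have "(\<Sum>l<t + T. (if l = t then - 1 else 0) * s (i + l)) =
          (\<Sum>l<t + T. if l = t then - s (i + l) else 0)"
      by (intro sum.cong) auto
    also have "\<dots> = - s (i + t)" using T by (subst sum.delta) auto
    finally show ?thesis using per[of i] by (simp add: add.assoc)
  qed
  then have "Nth_linear_complexity s N \<le> t + T" for N
    by (intro Nth_linear_complexity_le[of _ _ _ "\<lambda>l. if l = t then - 1 else 0"])
       (simp add: satisfies_recurrence_def)
  then have "linear_complexity s \<le> enat (t + T)"
    unfolding linear_complexity_def by (intro SUP_least) simp
  then show ?thesis by (cases "linear_complexity s") simp_all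
qed


text \<open>A bivariate polynomial h(x,y) is encoded as a polynomial in y whose coefficients are
  polynomials in x: the coefficient of x^i y^j is \<open>coeff (coeff h j) i\<close>.
  The total degree below is only meaningful for nonzero h.\<close>

definition total_degree :: "'a::zero poly poly \<Rightarrow> nat" where
  "total_degree h = Max {i + j | i j. coeff (coeff h j) i \<noteq> 0}"

definition eval_at_fps :: "'a::comm_ring_1 poly poly \<Rightarrow> 'a fps \<Rightarrow> 'a fps" where
  "eval_at_fps h G = poly (map_poly fps_of_poly h) G"

definition generating_function :: "(nat \<Rightarrow> 'a) \<Rightarrow> 'a fps" where
  "generating_function s = Abs_fps s"

definition expansion_complexity :: "(nat \<Rightarrow> 'a::comm_ring_1) \<Rightarrow> nat \<Rightarrow> nat" where
  "expansion_complexity s N =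
     (if \<forall>i<N. s i = 0 then 0
      else (LEAST d. \<exists>h. h \<noteq> 0 \<and> total_degree h = d \<and>
                         fps_X ^ N dvd eval_at_fps h (generating_function s)))"

end

theory Submission
  imports Defs
begin

text \<open>
  The generating function of an ultimately periodic sequence is rational. Write it in lowest
  terms as \<open>G = g / f\<close>. Two facts translate the data of the sequence into degrees:
  \<open>L = max (deg f) (deg g + 1)\<close>, because the polynomials \<open>p\<close> for which \<open>p * G\<close> is again a
  polynomial are the multiples of \<open>f\<close> (\<open>linear_complexity_reduced_fraction\<close>), and the preperiod
  is \<open>t = deg g + 1 - deg f\<close>, cut off at zero, because the numerator of \<open>G\<close> over the denominator
  \<open>1 - x^T\<close> must have degree below \<open>t + T\<close> (\<open>preperiod_reduced_fraction\<close>). Consequently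
  \<open>L - t = deg f\<close>, while \<open>L - min 1 (t - 1) = max (deg f + 1) (deg g)\<close> is the total degree \<open>M\<close> of
  the polynomial \<open>f * y - g\<close>, which annihilates \<open>G\<close>. This polynomial gives the upper bound.

  For the lower bound let \<open>h\<close> have total degree \<open>d\<close> and \<open>h(x,G) \<equiv> 0\<close> modulo \<open>x^N\<close>. Multiplying by
  \<open>f^d\<close> clears the denominators and turns \<open>h(x,G)\<close> into a polynomial in \<open>x\<close> of degree at
  most \<open>d * M\<close> that is divisible by \<open>x^N\<close>. Either this polynomial is nonzero, and then
  \<open>N \<le> d * M\<close>; or \<open>h(x, g/f) = 0\<close>, and then, as in the rational root test, \<open>f\<close> divides the
  leading coefficient of \<open>h\<close> with respect to \<open>y\<close>, which forces \<open>d \<ge> deg f + 1\<close>. The lemma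
  \<open>total_degree_annihilator_ge\<close> is this dichotomy, and the two cases of the theorem compare its
  alternatives.
\<close>

section \<open>Total degree\<close>

lemma finite_total_degree_set:
  "finite {i + j | i j. coeff (coeff h j) i \<noteq> 0}"
proof -
  have "{(i, j). coeff (coeff h j) i \<noteq> 0} \<subseteq> (\<Union>j\<le>degree h. {..degree (coeff h j)} \<times> {j})"
    by (auto simp: not_less intro!: le_degree)
  then have "finite {(i, j). coeff (coeff h j) i \<noteq> 0}"
    by (rule finite_subset) auto
  then have "finite ((\<lambda>(i, j). i + j) ` {(i, j). coeff (coeff h j) i \<noteq> 0})"
    by (rule finite_imageI)
  also have "(\<lambda>(i, j). i + j) ` {(i, j). coeff (coeff h j) i \<noteq> 0} =
    {i + j | i j. coeff (coeff h j) i \<noteq> 0}"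
    by auto
  finally show ?thesis .
qed

lemma le_total_degree:
  assumes "coeff (coeff h j) i \<noteq> 0"
  shows "i + j \<le> total_degree h"
  unfolding total_degree_def using assms
  by (intro Max_ge finite_total_degree_set) auto

lemma degree_coeff_le_total_degree:
  assumes "coeff h j \<noteq> 0"
  shows "degree (coeff h j) + j \<le> total_degree h"
  using assms by (intro le_total_degree) (simp add: leading_coeff_neq_0)

lemma total_degree_le:
  assumes "h \<noteq> 0" and "\<And>j. coeff h j \<noteq> 0 \<Longrightarrow> degree (coeff h j) + j \<le> d"
  shows "total_degree h \<le> d"
proof -
  have "coeff (coeff h (degree h)) (degree (coeff h (degree h))) \<noteq> 0"
    using assms(1) by (simp add: leading_coeff_neq_0)
  then have "{i + j | i j. coeff (coeff h j) i \<noteq> 0} \<noteq> {}"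
    by blast
  moreover have "i + j \<le> d" if "coeff (coeff h j) i \<noteq> 0" for i j
    using assms(2)[of j] le_degree[OF that] that by fastforce
  ultimately show ?thesis
    unfolding total_degree_def using finite_total_degree_set[of h] by (subst Max_le_iff) auto
qed

section \<open>Power series that are rational functions\<close>

unbundle fps_syntax

lemma fps_X_power_dvd_iff:
  fixes F :: "'a::comm_ring_1 fps"
  shows "fps_X ^ n dvd F \<longleftrightarrow> (\<forall>i<n. F $ i = 0)"
proof
  assume "fps_X ^ n dvd F"
  then show "\<forall>i<n. F $ i = 0"
    by (auto simp: fps_X_power_mult_nth elim!: dvdE)
next
  assume "\<forall>i<n. F $ i = 0"
  then have "F = fps_X ^ n * fps_shift n F"
    by (intro fps_ext) (simp add: fps_X_power_mult_nth)
  then show "fps_X ^ n dvd F"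
    by (rule dvdI)
qed

lemma poly_eq_0_if_fps_X_power_dvd:
  fixes p :: "'a::comm_ring_1 poly"
  assumes "fps_X ^ n dvd fps_of_poly p" and "degree p < n"
  shows "p = 0"
proof -
  have "coeff p (degree p) = 0"
    using assms by (simp add: fps_X_power_dvd_iff)
  then show ?thesis
    by simp
qed

lemma obtain_poly_of_fps:
  fixes F :: "'a::zero fps"
  assumes "\<And>n. n \<ge> K \<Longrightarrow> F $ n = 0"
  obtains p where "fps_of_poly p = F"
proof
  show "fps_of_poly (truncate_fps K F) = F"
    using assms by (intro fps_ext) (simp add: coeff_truncate_fps)
qed

text \<open>Lowest terms are expressed by the ideal of all denominators of \<open>G\<close> instead of by
  coprimality: \<open>f\<close> has to generate this ideal. Every argument below uses coprimality in exactly
  this form, so that no Bezout identity enters.\<close>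

definition reduced_fraction :: "'a::field poly \<Rightarrow> 'a poly \<Rightarrow> 'a fps \<Rightarrow> bool" where
  "reduced_fraction f g G \<longleftrightarrow> f \<noteq> 0 \<and> fps_of_poly f * G = fps_of_poly g \<and>
     (\<forall>p r. fps_of_poly p * G = fps_of_poly r \<longrightarrow> f dvd p)"

text \<open>A denominator of least degree works, since the remainder of any other denominator modulo it
  is again a denominator.\<close>

lemma reduced_fraction_exists:
  fixes G :: "'a::field fps"
  assumes "p \<noteq> 0" and "fps_of_poly p * G = fps_of_poly r"
  obtains f g where "reduced_fraction f g G"
proof -
  define D where "D p \<longleftrightarrow> p \<noteq> 0 \<and> (\<exists>r. fps_of_poly p * G = fps_of_poly r)" for p
  obtain f where f: "D f" and least: "\<And>p. D p \<Longrightarrow> degree f \<le> degree p"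
    using assms arg_min_natI[of D p degree] arg_min_nat_le[of D _ degree] unfolding D_def by blast
  from f obtain g where g: "fps_of_poly f * G = fps_of_poly g" and "f \<noteq> 0"
    unfolding D_def by blast
  have "f dvd p" if "fps_of_poly p * G = fps_of_poly r" for p r
  proof -
    have "fps_of_poly (p mod f) * G = fps_of_poly (r - (p div f) * g)"
      using that g
      by (simp add: minus_div_mult_eq_mod[symmetric] fps_of_poly_diff fps_of_poly_mult
          algebra_simps)
    then have "p mod f = 0 \<or> degree f \<le> degree (p mod f)"
      using least[of "p mod f"] unfolding D_def by blast
    then have "p mod f = 0"
      using degree_mod_less[OF \<open>f \<noteq> 0\<close>, of p] by auto
    then show ?thesis
      by auto
  qed
  then have "reduced_fraction f g G"
    unfolding reduced_fraction_def using g \<open>f \<noteq> 0\<close> by blast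
  then show ?thesis
    by (rule that)
qed

lemma reduced_fraction_extend:
  assumes "reduced_fraction f g G"
  shows "fps_of_poly (f * k) * G = fps_of_poly (g * k)"
  using assms by (simp add: reduced_fraction_def fps_of_poly_mult mult.assoc mult.left_commute)

lemma reduced_fraction_cross_mult:
  assumes "reduced_fraction f g G" and "p * g = r * f"
  shows "fps_of_poly p * G = fps_of_poly r"
proof -
  have "fps_of_poly f * (fps_of_poly p * G) = fps_of_poly (p * g)"
    using assms(1) by (simp add: reduced_fraction_def fps_of_poly_mult mult.left_commute)
  also have "\<dots> = fps_of_poly f * fps_of_poly r"
    by (metis assms(2) fps_of_poly_mult mult.commute)
  finally show ?thesis
    using assms(1) by (simp add: reduced_fraction_def fps_of_poly_eq_iff flip: fps_of_poly_0)
qed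

lemma reduced_fraction_dvd_cancel:
  assumes "reduced_fraction f g G" and "f dvd p * g"
  shows "f dvd p"
  using assms reduced_fraction_cross_mult[OF assms(1), of p]
  unfolding reduced_fraction_def by (metis dvdE mult.commute)

lemma reduced_fraction_dvd_cancel_power:
  assumes "reduced_fraction f g G" and "f dvd p * g ^ n"
  shows "f dvd p"
  using assms(2)
proof (induction n)
  case (Suc n)
  then have "f dvd (p * g ^ n) * g"
    by (simp add: mult_ac)
  then show ?case
    using reduced_fraction_dvd_cancel[OF assms(1)] Suc.IH by blast
qed simp

section \<open>Annihilating polynomials of a rational series\<close>

lemma eval_at_fps_linear:
  "eval_at_fps [:- g, f:] G = fps_of_poly f * G - fps_of_poly g"
  by (simp add: eval_at_fps_def map_poly_pCons fps_of_poly_uminus mult.commute)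

lemma total_degree_linear_le:
  fixes f g :: "'a::field poly"
  assumes "f \<noteq> 0"
  shows "total_degree [:- g, f:] \<le> max (degree f + 1) (degree g)"
  using assms by (intro total_degree_le) (auto simp: coeff_pCons split: nat.splits)

lemma eval_at_fps_altdef:
  assumes "degree h \<le> d"
  shows "eval_at_fps h G = (\<Sum>j\<le>d. fps_of_poly (coeff h j) * G ^ j)"
proof -
  have "degree (map_poly fps_of_poly h) \<le> degree h"
    by (rule map_poly_degree_leq)
  then have "(\<Sum>j\<le>d. coeff (map_poly fps_of_poly h) j * G ^ j) =
      poly (map_poly fps_of_poly h) G"
    unfolding poly_altdef using assms
    by (intro sum.mono_neutral_right) (auto simp: coeff_eq_0)
  then show ?thesis
    by (simp add: eval_at_fps_def coeff_map_poly)
qed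

text \<open>The numerator of \<open>h(x, g/f)\<close> over the common denominator \<open>f^d\<close>.\<close>

definition homogenization :: "'a::comm_ring_1 poly poly \<Rightarrow> nat \<Rightarrow> 'a poly \<Rightarrow> 'a poly \<Rightarrow> 'a poly" where
  "homogenization h d f g = (\<Sum>j\<le>d. coeff h j * g ^ j * f ^ (d - j))"

lemma fps_of_poly_homogenization:
  assumes "degree h \<le> d" and G: "fps_of_poly f * G = fps_of_poly g"
  shows "fps_of_poly (homogenization h d f g) = fps_of_poly f ^ d * eval_at_fps h G"
proof -
  have "fps_of_poly (coeff h j * g ^ j * f ^ (d - j)) =
      fps_of_poly f ^ d * (fps_of_poly (coeff h j) * G ^ j)" if "j \<le> d" for j
  proof -
    have "fps_of_poly (coeff h j * g ^ j * f ^ (d - j)) =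
        fps_of_poly (coeff h j) * (fps_of_poly f * G) ^ j * fps_of_poly f ^ (d - j)"
      by (simp add: G fps_of_poly_mult fps_of_poly_power)
    also have "\<dots> = fps_of_poly f ^ (j + (d - j)) * (fps_of_poly (coeff h j) * G ^ j)"
      by (simp only: power_add power_mult_distrib mult_ac)
    finally show ?thesis
      using that by simp
  qed
  then show ?thesis
    using assms(1) unfolding homogenization_def
    by (simp add: eval_at_fps_altdef fps_of_poly_sum sum_distrib_left)
qed

text \<open>A monomial \<open>x^i * y^j\<close> with \<open>i + j \<le> d\<close> contributes degree at most
  \<open>i + j * deg g + (d - j) * deg f\<close>. Spending the \<open>d - j \<ge> i\<close> remaining factors on
  \<open>deg f + 1\<close> instead shows that each of the \<open>d\<close> factors costs at most
  \<open>max (deg f + 1) (deg g)\<close>.\<close>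

lemma degree_homogenization_le:
  "degree (homogenization h (total_degree h) f g) \<le>
     total_degree h * max (degree f + 1) (degree g)"
  unfolding homogenization_def
proof (rule degree_sum_le)
  fix j assume "j \<in> {..total_degree h}"
  define d where "d = total_degree h"
  define M where "M = max (degree f + 1) (degree g)"
  have j: "j \<le> d"
    using \<open>j \<in> _\<close> by (simp add: d_def)
  show "degree (coeff h j * g ^ j * f ^ (total_degree h - j)) \<le>
    total_degree h * max (degree f + 1) (degree g)"
    unfolding d_def[symmetric] M_def[symmetric]
  proof (cases "coeff h j = 0")
    case False
    then have "degree (coeff h j) \<le> d - j"
      using degree_coeff_le_total_degree[of h j] by (simp add: d_def)
    moreover have "degree (g ^ j) \<le> j * degree g" "degree (f ^ (d - j)) \<le> (d - j) * degree f"
      using degree_power_le[of g j] degree_power_le[of f "d - j"] by (simp_all add: mult.commute)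
    ultimately have "degree (coeff h j * g ^ j * f ^ (d - j)) \<le>
        (d - j) + j * degree g + (d - j) * degree f"
      using degree_mult_le[of "coeff h j * g ^ j" "f ^ (d - j)"]
        degree_mult_le[of "coeff h j" "g ^ j"] by linarith
    also have "\<dots> = j * degree g + (d - j) * (degree f + 1)"
      by simp
    also have "\<dots> \<le> j * M + (d - j) * M"
      by (intro add_mono mult_le_mono2) (simp_all add: M_def)
    also have "\<dots> = d * M"
      using j by (simp flip: distrib_right)
    finally show "degree (coeff h j * g ^ j * f ^ (d - j)) \<le> d * M" .
  qed simp
qed simp

text \<open>The rational root test: in \<open>\<Sum> h\<^sub>j * g^j * f^(D - j) = 0\<close>, where \<open>D\<close> is the
  degree in \<open>y\<close>, every summand except the one for \<open>j = D\<close> is visibly a multiple of \<open>f\<close>.\<close>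

lemma denominator_dvd_lead_coeff:
  assumes red: "reduced_fraction f g G" and "eval_at_fps h G = 0"
  shows "f dvd lead_coeff h"
proof -
  define D where "D = degree h"
  have "fps_of_poly (homogenization h D f g) = 0"
    using assms fps_of_poly_homogenization[of h D f G g] by (simp add: D_def reduced_fraction_def)
  then have "homogenization h D f g = 0"
    by (simp add: fps_of_poly_eq_iff flip: fps_of_poly_0)
  define R where "R = (\<Sum>j<D. coeff h j * g ^ j * f ^ (D - j))"
  have "f dvd R"
    unfolding R_def by (intro dvd_sum dvd_mult dvd_power) simp
  moreover have "homogenization h D f g = coeff h D * g ^ D + R"
    by (simp add: homogenization_def R_def lessThan_Suc_atMost[symmetric])
  then have "f dvd coeff h D * g ^ D + R"
    using \<open>homogenization h D f g = 0\<close> by simp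
  ultimately have "f dvd coeff h D * g ^ D"
    by (simp only: dvd_add_left_iff)
  then have "f dvd coeff h D"
    by (rule reduced_fraction_dvd_cancel_power[OF red])
  then show ?thesis
    by (simp add: D_def)
qed

lemma total_degree_annihilator_ge_of_eq_0:
  assumes red: "reduced_fraction f g G" and "h \<noteq> 0" and zero: "eval_at_fps h G = 0"
  shows "degree f + 1 \<le> total_degree h"
proof -
  have "degree h \<noteq> 0"
  proof
    assume "degree h = 0"
    then have "eval_at_fps h G = fps_of_poly (lead_coeff h)"
      by (simp add: eval_at_fps_altdef[of h 0])
    then show False
      using zero \<open>h \<noteq> 0\<close> by (simp add: fps_of_poly_eq_iff flip: fps_of_poly_0)
  qed
  moreover have "degree f \<le> degree (lead_coeff h)"
    using denominator_dvd_lead_coeff[OF red zero] \<open>h \<noteq> 0\<close> by (intro dvd_imp_degree_le) auto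
  moreover have "degree (lead_coeff h) + degree h \<le> total_degree h"
    using \<open>h \<noteq> 0\<close> by (intro degree_coeff_le_total_degree) simp
  ultimately show ?thesis
    by linarith
qed

text \<open>The numerator over \<open>f^d\<close>, with \<open>d\<close> the total degree, is divisible by \<open>x^N\<close>, so if
  \<open>N\<close> exceeds the bound on its degree, it vanishes, and \<open>h\<close> annihilates \<open>G\<close> exactly.\<close>

lemma total_degree_annihilator_ge:
  assumes red: "reduced_fraction f g G" and "h \<noteq> 0" and dvd: "fps_X ^ N dvd eval_at_fps h G"
  shows "degree f + 1 \<le> total_degree h \<or> N \<le> total_degree h * max (degree f + 1) (degree g)"
proof (rule disjCI)
  define d where "d = total_degree h"
  assume "\<not> N \<le> total_degree h * max (degree f + 1) (degree g)"
  then have "degree (homogenization h d f g) < N"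
    using degree_homogenization_le[of h f g] by (simp add: d_def)
  moreover have "degree h \<le> d"
    using degree_coeff_le_total_degree[of h "degree h"] \<open>h \<noteq> 0\<close> by (simp add: d_def)
  then have eq: "fps_of_poly (homogenization h d f g) = fps_of_poly f ^ d * eval_at_fps h G"
    using red by (intro fps_of_poly_homogenization) (auto simp: reduced_fraction_def)
  moreover have "fps_X ^ N dvd fps_of_poly (homogenization h d f g)"
    unfolding eq using dvd by (rule dvd_mult)
  ultimately have "fps_of_poly f ^ d * eval_at_fps h G = 0"
    using poly_eq_0_if_fps_X_power_dvd[of N "homogenization h d f g"] by simp
  moreover have "fps_of_poly f \<noteq> 0"
    using red by (simp add: reduced_fraction_def fps_of_poly_eq_iff flip: fps_of_poly_0)
  ultimately have "eval_at_fps h G = 0"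
    by simp
  then show "degree f + 1 \<le> total_degree h"
    using red \<open>h \<noteq> 0\<close> by (intro total_degree_annihilator_ge_of_eq_0)
qed

section \<open>Linear complexity in terms of degrees\<close>

lemma generating_function_nth [simp]: "generating_function s $ n = s n"
  by (simp add: generating_function_def)

text \<open>The reciprocal of the characteristic polynomial of a recurrence. Multiplying the generating
  function by it evaluates the recurrence at every position.\<close>

definition feedback_poly :: "nat \<Rightarrow> (nat \<Rightarrow> 'a::comm_ring_1) \<Rightarrow> 'a poly" where
  "feedback_poly l c = 1 + (\<Sum>k<l. monom (c k) (l - k))"

lemma coeff_feedback_poly:
  "coeff (feedback_poly l c) n = (if n = 0 then 1 else if n \<le> l then c (l - n) else 0)"
proof -
  have "coeff (feedback_poly l c) n =
      (if n = 0 then 1 else 0) + (\<Sum>k<l. if l - k = n then c k else 0)"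
    by (simp add: feedback_poly_def coeff_sum)
  also have "(\<Sum>k<l. if l - k = n then c k else 0) =
      (\<Sum>k<l. if k = l - n then (if 0 < n \<and> n \<le> l then c k else 0) else 0)"
    by (intro sum.cong) auto
  finally show ?thesis
    by auto
qed

lemma degree_feedback_poly_le: "degree (feedback_poly l c) \<le> l"
  by (rule degree_le) (simp add: coeff_feedback_poly)

lemma feedback_poly_mult_nth:
  "(fps_of_poly (feedback_poly l c) * generating_function s) $ (i + l) =
     s (i + l) + (\<Sum>k<l. c k * s (i + k))"
proof -
  have "(fps_const (c k) * fps_X ^ (l - k) * generating_function s) $ (i + l) = c k * s (i + k)"
    if "k < l" for k
    using that by (simp add: mult.assoc fps_X_power_mult_nth)
  then show ?thesis
    by (simp add: feedback_poly_def fps_of_poly_add fps_of_poly_sum fps_of_poly_monom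
        distrib_right sum_distrib_right fps_sum_nth)
qed

lemma satisfies_recurrence_iff:
  "satisfies_recurrence s N l c \<longleftrightarrow>
     (\<forall>n. l \<le> n \<and> n < N \<longrightarrow>
        (fps_of_poly (feedback_poly l c) * generating_function s) $ n = 0)"
  unfolding satisfies_recurrence_def feedback_poly_mult_nth[symmetric]
  by (metis le_add2 le_add_diff_inverse2)

lemma Nth_linear_complexity_satisfied:
  "\<exists>c. satisfies_recurrence s N (Nth_linear_complexity s N) c"
proof -
  have "satisfies_recurrence s N N (\<lambda>_. 0)"
    by (simp add: satisfies_recurrence_def)
  then show ?thesis
    unfolding Nth_linear_complexity_def
    by (intro LeastI[of "\<lambda>L. \<exists>c. satisfies_recurrence s N L c" N]) blast
qed

text \<open>A recurrence of length \<open>l\<close> for the first \<open>N\<close> terms says \<open>p * G \<equiv> r\<close> modulo \<open>x^N\<close> with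
  \<open>deg p \<le> l\<close> and \<open>deg r < l\<close>. For large \<open>N\<close> this congruence is an equality, because after
  multiplication by \<open>f\<close> it compares two polynomials of degree below \<open>N\<close>.\<close>

lemma recurrence_length_ge:
  fixes s :: "nat \<Rightarrow> 'a::field"
  assumes red: "reduced_fraction f g (generating_function s)" and "g \<noteq> 0"
    and rec: "satisfies_recurrence s N l c" and N: "l + max (degree f) (degree g + 1) \<le> N"
  shows "max (degree f) (degree g + 1) \<le> l"
proof -
  define G where "G = generating_function s"
  define p where "p = feedback_poly l c"
  define r where "r = truncate_fps l (fps_of_poly p * G)"
  have "f \<noteq> 0" and fG: "fps_of_poly f * G = fps_of_poly g"
    using red by (simp_all add: reduced_fraction_def G_def)
  have deg_p: "degree p \<le> l"
    by (simp add: p_def degree_feedback_poly_le)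
  have "coeff p 0 = 1"
    by (simp add: p_def coeff_feedback_poly)
  then have "p \<noteq> 0"
    by auto
  have deg_r: "degree r < l" if "r \<noteq> 0"
    using that degree_truncate_fps[of l "fps_of_poly p * G"] unfolding r_def by (cases "l = 0") auto
  have "fps_X ^ N dvd fps_of_poly p * G - fps_of_poly r"
    using rec
    by (auto simp: fps_X_power_dvd_iff satisfies_recurrence_iff r_def coeff_truncate_fps
        p_def[symmetric] G_def[symmetric])
  then have "fps_X ^ N dvd fps_of_poly f * (fps_of_poly p * G - fps_of_poly r)"
    by (rule dvd_mult)
  also have "\<dots> = fps_of_poly (p * g - r * f)"
    by (simp add: fps_of_poly_diff fps_of_poly_mult algebra_simps flip: fG)
  finally have "fps_X ^ N dvd fps_of_poly (p * g - r * f)" .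
  moreover have "degree (p * g - r * f) < N"
  proof (rule degree_diff_less)
    show "degree (p * g) < N"
      using N deg_p degree_mult_le[of p g] by linarith
    show "degree (r * f) < N"
      using N deg_r degree_mult_le[of r f] by (cases "r = 0") auto
  qed
  ultimately have "p * g - r * f = 0"
    by (rule poly_eq_0_if_fps_X_power_dvd)
  then have pg: "p * g = r * f"
    by simp
  then have "f dvd p"
    using red reduced_fraction_cross_mult[OF red pg] unfolding reduced_fraction_def by blast
  then have deg_f: "degree f \<le> degree p"
    using \<open>p \<noteq> 0\<close> by (rule dvd_imp_degree_le)
  have "r \<noteq> 0"
    using pg \<open>p \<noteq> 0\<close> \<open>g \<noteq> 0\<close> by auto
  have "degree p + degree g = degree r + degree f"
    using arg_cong[OF pg, of degree] \<open>p \<noteq> 0\<close> \<open>g \<noteq> 0\<close> \<open>r \<noteq> 0\<close> \<open>f \<noteq> 0\<close>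
    by (simp add: degree_mult_eq)
  then show ?thesis
    using deg_f deg_p deg_r[OF \<open>r \<noteq> 0\<close>] by linarith
qed

lemma linear_complexity_reduced_fraction:
  fixes s :: "nat \<Rightarrow> 'a::field"
  assumes red: "reduced_fraction f g (generating_function s)" and "g \<noteq> 0" and f0: "coeff f 0 \<noteq> 0"
  shows "linear_complexity s = enat (max (degree f) (degree g + 1))"
proof (rule antisym)
  define K where "K = max (degree f) (degree g + 1)"
  define c where "c k = coeff f (K - k) / coeff f 0" for k
  \<comment> \<open>The polynomial \<open>f\<close>, normalized to constant term 1, is itself a feedback polynomial.\<close>
  have feedback: "feedback_poly K c = smult (inverse (coeff f 0)) f"
    using f0 by (intro poly_eqI)
      (auto simp: coeff_feedback_poly c_def K_def field_simps coeff_eq_0)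
  have "(fps_of_poly (feedback_poly K c) * generating_function s) $ n = 0" if "K \<le> n" for n
  proof -
    have "fps_of_poly (feedback_poly K c) * generating_function s =
        fps_of_poly (smult (inverse (coeff f 0)) g)"
      using red by (simp add: feedback reduced_fraction_def fps_of_poly_smult mult.assoc)
    then show ?thesis
      using that by (simp add: K_def coeff_eq_0)
  qed
  then have "satisfies_recurrence s N K c" for N
    by (simp add: satisfies_recurrence_iff)
  then have "Nth_linear_complexity s N \<le> K" for N
    by (rule Nth_linear_complexity_le)
  then show "linear_complexity s \<le> enat K"
    unfolding linear_complexity_def by (intro SUP_least) simp
  \<comment> \<open>A shortest recurrence for the first \<open>2 * K\<close> terms has length at most \<open>K\<close>, which leaves
    enough terms for the congruence that it expresses to be an equality.\<close>
  obtain c' where "satisfies_recurrence s (2 * K) (Nth_linear_complexity s (2 * K)) c'"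
    using Nth_linear_complexity_satisfied by blast
  then have "K \<le> Nth_linear_complexity s (2 * K)"
    using recurrence_length_ge[OF red \<open>g \<noteq> 0\<close>] \<open>Nth_linear_complexity s (2 * K) \<le> K\<close>
    unfolding K_def[symmetric] by (simp add: mult_2)
  then have "enat K \<le> enat (Nth_linear_complexity s (2 * K))"
    by simp
  also have "\<dots> \<le> linear_complexity s"
    unfolding linear_complexity_def by (intro SUP_upper) (simp add: K_def)
  finally show "enat K \<le> linear_complexity s" .
qed

section \<open>The preperiod in terms of degrees\<close>

lemma has_preperiod_period_iff_nth:
  fixes s :: "nat \<Rightarrow> 'a::comm_ring_1"
  shows "has_preperiod_period s t T \<longleftrightarrow> T \<ge> 1 \<and>
     (\<forall>n\<ge>t + T. (fps_of_poly (1 - monom 1 T) * generating_function s) $ n = 0)"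
proof -
  have nth: "(fps_of_poly (1 - monom 1 T) * generating_function s) $ (i + t + T) =
      s (i + t + T) - s (i + t)" for i
    by (simp add: fps_of_poly_diff fps_of_poly_monom' left_diff_distrib fps_X_power_mult_nth)
  have "(\<forall>i. s (i + t + T) = s (i + t)) \<longleftrightarrow>
      (\<forall>n\<ge>t + T. (fps_of_poly (1 - monom 1 T) * generating_function s) $ n = 0)"
    (is "?per \<longleftrightarrow> ?zero")
  proof
    assume ?per
    then show ?zero
      by (metis nth right_minus_eq le_add_diff_inverse2 add.assoc)
  next
    assume ?zero
    then show ?per
      using nth by (metis right_minus_eq le_add2 add.assoc)
  qed
  then show ?thesis
    by (simp add: has_preperiod_period_def)
qed

lemma has_preperiod_period_numerator:
  fixes s :: "nat \<Rightarrow> 'a::comm_ring_1"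
  assumes "has_preperiod_period s t T"
  obtains r where "fps_of_poly r = fps_of_poly (1 - monom 1 T) * generating_function s"
proof (rule obtain_poly_of_fps)
  show "(fps_of_poly (1 - monom 1 T) * generating_function s) $ n = 0" if "t + T \<le> n" for n
    using assms that by (simp add: has_preperiod_period_iff_nth)
qed

lemma one_minus_monom:
  assumes "T \<ge> 1"
  shows "degree (1 - monom 1 T :: 'a::field poly) = T"
    and "1 - monom 1 T \<noteq> (0 :: 'a poly)"
    and "coeff (1 - monom 1 T :: 'a poly) 0 = 1"
proof -
  show c0: "coeff (1 - monom 1 T :: 'a poly) 0 = 1"
    using assms by simp
  then show "1 - monom 1 T \<noteq> (0 :: 'a poly)"
    by (metis coeff_0 zero_neq_one)
  have "degree (1 + - monom 1 T :: 'a poly) = degree (- monom 1 T :: 'a poly)"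
    using assms by (intro degree_add_eq_right) (simp add: degree_monom_eq)
  then show "degree (1 - monom 1 T :: 'a poly) = T"
    by (simp add: degree_monom_eq)
qed

text \<open>If \<open>f\<close> divides \<open>1 - x^T\<close>, then the numerator of \<open>G\<close> over the denominator \<open>1 - x^T\<close> has
  degree \<open>deg g + T - deg f\<close>. The sequence is \<open>T\<close>-periodic from position \<open>t\<close> on iff this is less than \<open>t + T\<close>, a condition
  in which \<open>T\<close> cancels.\<close>

lemma has_preperiod_period_reduced_fraction:
  fixes s :: "nat \<Rightarrow> 'a::field"
  assumes red: "reduced_fraction f g (generating_function s)" and "g \<noteq> 0"
  shows "has_preperiod_period s t T \<longleftrightarrow>
    T \<ge> 1 \<and> f dvd 1 - monom 1 T \<and> degree g + 1 \<le> t + degree f"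
proof (cases "T \<ge> 1 \<and> f dvd 1 - monom 1 T")
  case True
  then obtain k where k: "1 - monom 1 T = f * k" and T: "T \<ge> 1"
    by (auto elim!: dvdE)
  have "f \<noteq> 0" and "k \<noteq> 0"
    using one_minus_monom(2)[OF T, where 'a = 'a] unfolding k by auto
  then have deg_k: "degree f + degree k = T"
    using one_minus_monom(1)[OF T, where 'a = 'a] by (simp add: k degree_mult_eq)
  have "g * k \<noteq> 0" and deg: "degree (g * k) = degree g + degree k"
    using \<open>g \<noteq> 0\<close> \<open>k \<noteq> 0\<close> by (simp_all add: degree_mult_eq)
  have "has_preperiod_period s t T \<longleftrightarrow> (\<forall>n\<ge>t + T. coeff (g * k) n = 0)"
    using T reduced_fraction_extend[OF red, of k] by (simp add: has_preperiod_period_iff_nth k)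
  also have "\<dots> \<longleftrightarrow> degree (g * k) < t + T"
  proof
    assume "\<forall>n\<ge>t + T. coeff (g * k) n = 0"
    then show "degree (g * k) < t + T"
      using \<open>g * k \<noteq> 0\<close> leading_coeff_neq_0[of "g * k"] not_less by blast
  qed (simp add: coeff_eq_0)
  finally show ?thesis
    using True deg_k by (auto simp: deg)
next
  case False
  have "f dvd 1 - monom 1 T" if per: "has_preperiod_period s t T"
  proof -
    obtain r where "fps_of_poly r = fps_of_poly (1 - monom 1 T) * generating_function s"
      using per by (rule has_preperiod_period_numerator)
    then show ?thesis
      using red unfolding reduced_fraction_def by metis
  qed
  then show ?thesis
    using False by (auto simp: has_preperiod_period_def)
qed

lemma ultimately_periodic_reduced_fraction:
  fixes s :: "nat \<Rightarrow> 'a::field"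
  assumes "ultimately_periodic s" and nz: "generating_function s \<noteq> 0"
  obtains f g T where "reduced_fraction f g (generating_function s)" and "g \<noteq> 0"
    and "T \<ge> 1" and "f dvd 1 - monom 1 T" and "coeff f 0 \<noteq> 0"
proof -
  obtain t T where per: "has_preperiod_period s t T"
    using assms(1) by (auto simp: ultimately_periodic_def)
  then obtain r where r: "fps_of_poly r = fps_of_poly (1 - monom 1 T) * generating_function s"
    by (rule has_preperiod_period_numerator)
  have T: "T \<ge> 1"
    using per by (simp add: has_preperiod_period_def)
  obtain f g where red: "reduced_fraction f g (generating_function s)"
    using reduced_fraction_exists[OF one_minus_monom(2)[OF T] r[symmetric]] .
  have "fps_of_poly f \<noteq> 0"
    using red by (simp add: reduced_fraction_def fps_of_poly_eq_iff flip: fps_of_poly_0)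
  then have "fps_of_poly g \<noteq> 0"
    using red nz unfolding reduced_fraction_def by (metis mult_eq_0_iff)
  then have "g \<noteq> 0"
    by auto
  then have dvd: "f dvd 1 - monom 1 T"
    using per has_preperiod_period_reduced_fraction[OF red] by blast
  then obtain k where "1 - monom 1 T = f * k"
    by (rule dvdE)
  then have "coeff f 0 * coeff k 0 = 1"
    using one_minus_monom(3)[OF T, where 'a = 'a] by (simp add: coeff_mult)
  then have "coeff f 0 \<noteq> 0"
    by auto
  then show ?thesis
    using that red \<open>g \<noteq> 0\<close> T dvd by blast
qed

lemma preperiod_reduced_fraction:
  fixes s :: "nat \<Rightarrow> 'a::field"
  assumes "reduced_fraction f g (generating_function s)" and "g \<noteq> 0"
    and "T \<ge> 1" and "f dvd 1 - monom 1 T"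
  shows "preperiod s = degree g + 1 - degree f"
  unfolding preperiod_def has_preperiod_period_reduced_fraction[OF assms(1,2)]
  using assms(3,4) by (intro Least_equality) auto

section \<open>Bounds for the expansion complexity\<close>

lemma expansion_complexity_le:
  assumes "h \<noteq> 0" and "fps_X ^ N dvd eval_at_fps h (generating_function s)"
  shows "expansion_complexity s N \<le> total_degree h"
  unfolding expansion_complexity_def using assms by (auto intro!: Least_le)

lemma expansion_complexity_attained:
  assumes "\<exists>i<N. s i \<noteq> 0"
    and "h' \<noteq> 0" and "fps_X ^ N dvd eval_at_fps h' (generating_function s)"
  obtains h where "h \<noteq> 0" and "total_degree h = expansion_complexity s N"
    and "fps_X ^ N dvd eval_at_fps h (generating_function s)"
proof -
  define P where "P d \<longleftrightarrow> (\<exists>h. h \<noteq> 0 \<and> total_degree h = d \<and>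
      fps_X ^ N dvd eval_at_fps h (generating_function s))" for d
  have "P (total_degree h')"
    using assms(2,3) by (auto simp: P_def)
  then have "P (LEAST d. P d)"
    by (rule LeastI)
  moreover have "expansion_complexity s N = (LEAST d. P d)"
    using assms(1) by (auto simp: expansion_complexity_def P_def)
  ultimately have "P (expansion_complexity s N)"
    by simp
  then show ?thesis
    using that by (auto simp: P_def)
qed

lemma expansion_complexity_rational:
  fixes s :: "nat \<Rightarrow> 'a::field" and N :: nat
  assumes red: "reduced_fraction f g (generating_function s)"
  defines "E \<equiv> expansion_complexity s N" and "M \<equiv> max (degree f + 1) (degree g)"
  shows "E \<le> M" and "\<exists>i<N. s i \<noteq> 0 \<Longrightarrow> degree f + 1 \<le> E \<or> N \<le> E * M"
proof -
  have "f \<noteq> 0"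
    using red by (simp add: reduced_fraction_def)
  then have nz: "[:- g, f:] \<noteq> 0"
    by simp
  have zero: "fps_X ^ N dvd eval_at_fps [:- g, f:] (generating_function s)"
    using red by (simp add: eval_at_fps_linear reduced_fraction_def)
  show "E \<le> M"
    using expansion_complexity_le[OF nz zero] total_degree_linear_le[OF \<open>f \<noteq> 0\<close>, of g]
    by (simp add: E_def M_def)
  assume "\<exists>i<N. s i \<noteq> 0"
  then obtain h where "h \<noteq> 0" and deg: "total_degree h = expansion_complexity s N"
    and "fps_X ^ N dvd eval_at_fps h (generating_function s)"
    using nz zero by (rule expansion_complexity_attained)
  then show "degree f + 1 \<le> E \<or> N \<le> E * M"
    unfolding E_def M_def deg[symmetric] using red by (intro total_degree_annihilator_ge)
qed

theorem theorem1:
  fixes s :: "nat \<Rightarrow> 'a::{field,finite}" and t L N :: nat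
  assumes "ultimately_periodic s"
    and "t = preperiod s"
    and "linear_complexity s = enat L"
    and "generating_function s \<noteq> 0"
    and "N > 0"
  shows "((\<exists>i<N. s i \<noteq> 0) \<longrightarrow>
           int (expansion_complexity s N) \<ge>
             (if int N > (int L - int t) * (int L - min 1 (int t - 1))
              then int L - int t + 1
              else \<lceil>real N / real_of_int (int L - min 1 (int t - 1))\<rceil>)) \<and>
         int (expansion_complexity s N) \<le> int L + max (- 1) (- int t + 1)"
proof -
  obtain f g T where red: "reduced_fraction f g (generating_function s)" and "g \<noteq> 0"
    and T: "T \<ge> 1" "f dvd 1 - monom 1 T" and f0: "coeff f 0 \<noteq> 0"
    using ultimately_periodic_reduced_fraction[OF assms(1,4)] .
  define E where "E = expansion_complexity s N"
  define M where "M = max (degree f + 1) (degree g)"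
  have L: "L = max (degree f) (degree g + 1)"
    using linear_complexity_reduced_fraction[OF red \<open>g \<noteq> 0\<close> f0] assms(3) by simp
  have t: "t = degree g + 1 - degree f"
    using preperiod_reduced_fraction[OF red \<open>g \<noteq> 0\<close> T] assms(2) by simp
  have Lt: "int L - int t = int (degree f)"
    unfolding L t by (auto simp: max_def)
  have M: "int L - min 1 (int t - 1) = int M"
    unfolding L t M_def by (auto simp: max_def min_def)
  have "int E \<le> int L + max (- 1) (- int t + 1)"
  proof -
    have "int E \<le> int M"
      using expansion_complexity_rational(1)[OF red, of N] unfolding E_def M_def by simp
    then show ?thesis
      using M by linarith
  qed
  moreover have "int E \<ge> (if int N > int (degree f) * int M then int (degree f) + 1
      else \<lceil>real N / real_of_int (int M)\<rceil>)" if nz: "\<exists>i<N. s i \<noteq> 0"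
  proof -
    have "M > 0"
      by (simp add: M_def)
    have ceil: "\<lceil>real N / real_of_int (int M)\<rceil> \<le> int d" if "N \<le> d * M" for d
    proof -
      have "real N \<le> real d * real M"
        using that by (simp flip: of_nat_mult)
      then show ?thesis
        using \<open>M > 0\<close> by (simp add: ceiling_le_iff divide_le_eq)
    qed
    consider "degree f + 1 \<le> E" | "N \<le> E * M"
      using expansion_complexity_rational(2)[OF red nz] by (auto simp: E_def M_def)
    then show ?thesis
    proof cases
      case 1
      have "N \<le> E * M" if "N \<le> degree f * M"
        using that 1 by (meson add_leD1 le_trans mult_le_mono1)
      then show ?thesis
        using 1 ceil[of E] by (simp flip: of_nat_mult)
    next
      case 2
      have "degree f + 1 \<le> E" if "degree f * M < N"
        using that 2 mult_less_cancel2[of "degree f" M E] by linarith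
      then show ?thesis
        using ceil[OF 2] by (auto simp flip: of_nat_mult)
    qed
  qed
  ultimately show ?thesis
    unfolding Lt M E_def[symmetric] by blast
qed

end
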